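(* Let $m\ge 2$ and let $(x_1,\dots,x_{2m},y_1,\dots,y_{2m})$ be the coordinates of $\mathbb R^{4m}$. The functions $f_{ij}:=f_i\delta_{ij}$ ($1\le i,j\le 2m$), where $$f_1:=h\left(\frac{\sum_{j=2}^{2m}x_j^2}{\sum_{j=2}^{2m}y_j^2}\right),\qquad f_i:=\frac{x_i\left(\sum_{j=2}^{2m}y_j^2\right)}{y_i\left(\sum_{j=2}^{2m}x_j^2\right)},\quad 2\le i\le 2m,$$ and $h$ is a smooth real function of one real variable, are (where defined) a solution of the system $$\frac{\partial f_{jt}}{\partial x_i}-\frac{\partial f_{it}}{\partial x_j}+\sum_{k=1}^{2m}\left(f_{ik}\frac{\partial f_{jt}}{\partial y_k}-f_{jk}\frac{\partial f_{it}}{\partial y_k}\right)=0,\qquad\forall\, i\ne j,\ \forall\, t.$$ Moreover, on any open connected subset of $\mathbb R^{4m}$ on which the $f_i$ ($1\le i\le 2m$) are (defined and) non-vanishing and $$h\left(\frac{\sum_{j=2}^{2m}x_j^2}{\sum_{j=2}^{2m}y_j^2}\right)+\frac{\sum_{j=2}^{2m}x_j^2}{\sum_{j=2}^{2m}y_j^2}\,\dot h\left(\frac{\sum_{j=2}^{2m}x_j^2}{\sum_{j=2}^{2m}y_j^2}\right)\ne 0,$$ the associated almost para-quaternionic structure $\mathcal P_{(f_{ij})}$ is not para-quaternionic.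
   Context: An almost complex structure is an endomorphism $J$ of the tangent bundle with $J^2=-\mathrm{Id}$. An almost para-complex structure is an endomorphism $J$ with $J^2=\mathrm{Id}$ whose two eigenbundles $\mathrm{Ker}(J\pm\mathrm{Id})$ have the same rank. An almost para-quaternionic structure on a manifold $M$ of dimension $4m\ge 8$ is a rank three sub-bundle $\mathcal P\subset\mathrm{End}(TM)$ locally spanned by triples $\{J_1,J_2,J_3\}$ with $J_1$ almost complex, $J_2,J_3$ anti-commuting almost para-complex structures and $J_3=J_1J_2$. It is para-quaternionic if there is a torsion-free linear connection on $M$ preserving $\mathcal P$. Given smooth functions $f_{ij}=f_{ij}(x,y)$ ($1\le i,j\le 2m$) on an open subset $U$ of $\mathbb R^{4m}$ with $\det(f_{ij})\ne0$ everywhere and satisfying the system of the claim, define a bundle isomorphism $A$ from $\mathrm{Span}\{\partial/\partial x_i\}$ to $\mathrm{Span}\{\partial/\partial y_j\}$ by $A(\partial/\partial x_i)=\sum_{j=1}^{2m}f_{ij}\,\partial/\partial y_j$. The associated almost para-quaternionic structure is $\mathcal P_{(f_{ij})}:=\mathrm{Span}\{J_1,J_2,J_3\}$ on $U$, where, for $X\in\mathrm{Span}\{\partial/\partial x_i\}$ and $Y\in\mathrm{Span}\{\partial/\partial y_j\}$: $J_2X=X$, $J_2Y=-Y$, $J_1X=J_3X=AX$, $J_1Y=-J_3Y=-A^{-1}Y$. The notation $\dot h$ means the derivative of $h$. *)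

theory Defs
  imports "HOL-Analysis.Analysis"
begin

section \<open>Smooth maps and vector fields on open sets\<close>

text \<open>\<open>Ck_on\<close> and \<open>smooth_on\<close> are meant for open \<open>U\<close>. Maps are total functions, but only their
  values on \<open>U\<close> matter.\<close>

primrec Ck_on ::
  "nat \<Rightarrow> 'a::real_normed_vector set \<Rightarrow> ('a \<Rightarrow> 'b::real_normed_vector) \<Rightarrow> bool" where
  "Ck_on 0 U f \<longleftrightarrow> continuous_on U f"
| "Ck_on (Suc k) U f \<longleftrightarrow> (\<forall>p\<in>U. f differentiable (at p)) \<and>
     (\<forall>v. Ck_on k U (\<lambda>p. frechet_derivative f (at p) v))"

definition smooth_on ::
  "'a::real_normed_vector set \<Rightarrow> ('a \<Rightarrow> 'b::real_normed_vector) \<Rightarrow> bool" where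
  "smooth_on U f \<longleftrightarrow> (\<forall>k. Ck_on k U f)"

definition lie_bracket ::
  "('v::euclidean_space \<Rightarrow> 'v) \<Rightarrow> ('v \<Rightarrow> 'v) \<Rightarrow> 'v \<Rightarrow> 'v" where
  "lie_bracket X Y p =
     frechet_derivative Y (at p) (X p) - frechet_derivative X (at p) (Y p)"

section \<open>Linear connections\<close>

text \<open>A connection is an operator \<open>N X Y\<close> (the covariant derivative of \<open>Y\<close> along \<open>X\<close>) on the smooth
  vector fields of \<open>U\<close>. The second clause says that \<open>N\<close> only sees the restrictions to \<open>U\<close> of the
  total functions representing the fields.\<close>

definition linear_connection ::
  "'v::euclidean_space set \<Rightarrow> (('v \<Rightarrow> 'v) \<Rightarrow> ('v \<Rightarrow> 'v) \<Rightarrow> 'v \<Rightarrow> 'v) \<Rightarrow> bool" where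
  "linear_connection U N \<longleftrightarrow>
     (\<forall>X Y. smooth_on U X \<longrightarrow> smooth_on U Y \<longrightarrow> smooth_on U (N X Y)) \<and>
     (\<forall>X X' Y Y'. smooth_on U X \<longrightarrow> smooth_on U X' \<longrightarrow> smooth_on U Y \<longrightarrow> smooth_on U Y' \<longrightarrow>
        (\<forall>p\<in>U. X p = X' p \<and> Y p = Y' p) \<longrightarrow> (\<forall>p\<in>U. N X Y p = N X' Y' p)) \<and>
     (\<forall>X X' Y. smooth_on U X \<longrightarrow> smooth_on U X' \<longrightarrow> smooth_on U Y \<longrightarrow>
        (\<forall>p\<in>U. N (\<lambda>q. X q + X' q) Y p = N X Y p + N X' Y p)) \<and>
     (\<forall>g X Y. smooth_on U (g :: 'v \<Rightarrow> real) \<longrightarrow> smooth_on U X \<longrightarrow> smooth_on U Y \<longrightarrow>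
        (\<forall>p\<in>U. N (\<lambda>q. g q *\<^sub>R X q) Y p = g p *\<^sub>R N X Y p)) \<and>
     (\<forall>X Y Y'. smooth_on U X \<longrightarrow> smooth_on U Y \<longrightarrow> smooth_on U Y' \<longrightarrow>
        (\<forall>p\<in>U. N X (\<lambda>q. Y q + Y' q) p = N X Y p + N X Y' p)) \<and>
     (\<forall>g X Y. smooth_on U (g :: 'v \<Rightarrow> real) \<longrightarrow> smooth_on U X \<longrightarrow> smooth_on U Y \<longrightarrow>
        (\<forall>p\<in>U. N X (\<lambda>q. g q *\<^sub>R Y q) p =
           frechet_derivative g (at p) (X p) *\<^sub>R Y p + g p *\<^sub>R N X Y p))"

definition torsion_free ::
  "'v::euclidean_space set \<Rightarrow> (('v \<Rightarrow> 'v) \<Rightarrow> ('v \<Rightarrow> 'v) \<Rightarrow> 'v \<Rightarrow> 'v) \<Rightarrow> bool" where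
  "torsion_free U N \<longleftrightarrow>
     (\<forall>X Y. smooth_on U X \<longrightarrow> smooth_on U Y \<longrightarrow>
        (\<forall>p\<in>U. N X Y p - N Y X p - lie_bracket X Y p = 0))"

section \<open>Almost para-quaternionic structures\<close>

definition almost_complex ::
  "'v::euclidean_space set \<Rightarrow> ('v \<Rightarrow> 'v \<Rightarrow>\<^sub>L 'v) \<Rightarrow> bool" where
  "almost_complex U J \<longleftrightarrow> smooth_on U J \<and> (\<forall>p\<in>U. J p o\<^sub>L J p = - id_blinfun)"

definition almost_para_complex ::
  "'v::euclidean_space set \<Rightarrow> ('v \<Rightarrow> 'v \<Rightarrow>\<^sub>L 'v) \<Rightarrow> bool" where
  "almost_para_complex U J \<longleftrightarrow> smooth_on U J \<and>
     (\<forall>p\<in>U. J p o\<^sub>L J p = id_blinfun \<and>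
        dim {v. blinfun_apply (J p + id_blinfun) v = 0} =
        dim {v. blinfun_apply (J p - id_blinfun) v = 0})"

text \<open>A sub-bundle of the endomorphism bundle over \<open>U\<close> is given by its fibres \<open>P p\<close>; its smoothness
  is part of the existence of local smooth frames.\<close>

definition almost_para_quaternionic ::
  "'v::euclidean_space set \<Rightarrow> ('v \<Rightarrow> ('v \<Rightarrow>\<^sub>L 'v) set) \<Rightarrow> bool" where
  "almost_para_quaternionic U P \<longleftrightarrow>
     4 dvd DIM('v) \<and> 8 \<le> DIM('v) \<and>
     (\<forall>p\<in>U. subspace (P p) \<and> dim (P p) = 3) \<and>
     (\<forall>p\<in>U. \<exists>W J\<^sub>1 J\<^sub>2 J\<^sub>3. open W \<and> p \<in> W \<and> W \<subseteq> U \<and>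
        almost_complex W J\<^sub>1 \<and> almost_para_complex W J\<^sub>2 \<and> almost_para_complex W J\<^sub>3 \<and>
        (\<forall>q\<in>W. J\<^sub>2 q o\<^sub>L J\<^sub>3 q = - (J\<^sub>3 q o\<^sub>L J\<^sub>2 q) \<and> J\<^sub>3 q = J\<^sub>1 q o\<^sub>L J\<^sub>2 q \<and>
           P q = span {J\<^sub>1 q, J\<^sub>2 q, J\<^sub>3 q}))"

definition bundle_section ::
  "'v::euclidean_space set \<Rightarrow> ('v \<Rightarrow> ('v \<Rightarrow>\<^sub>L 'v) set) \<Rightarrow> ('v \<Rightarrow> 'v \<Rightarrow>\<^sub>L 'v) \<Rightarrow> bool" where
  "bundle_section U P J \<longleftrightarrow> smooth_on U J \<and> (\<forall>p\<in>U. J p \<in> P p)"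

text \<open>\<open>K\<close> below is the covariant derivative of the section \<open>J\<close> along \<open>X\<close>, for the connection induced
  on endomorphisms.\<close>

definition preserves ::
  "'v::euclidean_space set \<Rightarrow> (('v \<Rightarrow> 'v) \<Rightarrow> ('v \<Rightarrow> 'v) \<Rightarrow> 'v \<Rightarrow> 'v) \<Rightarrow>
   ('v \<Rightarrow> ('v \<Rightarrow>\<^sub>L 'v) set) \<Rightarrow> bool" where
  "preserves U N P \<longleftrightarrow>
     (\<forall>X J. smooth_on U X \<longrightarrow> bundle_section U P J \<longrightarrow>
        (\<exists>K. bundle_section U P K \<and>
           (\<forall>Y. smooth_on U Y \<longrightarrow>
              (\<forall>p\<in>U. blinfun_apply (K p) (Y p) =
                 N X (\<lambda>q. blinfun_apply (J q) (Y q)) p - blinfun_apply (J p) (N X Y p)))))"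

definition para_quaternionic ::
  "'v::euclidean_space set \<Rightarrow> ('v \<Rightarrow> ('v \<Rightarrow>\<^sub>L 'v) set) \<Rightarrow> bool" where
  "para_quaternionic U P \<longleftrightarrow> almost_para_quaternionic U P \<and>
     (\<exists>N. linear_connection U N \<and> torsion_free U N \<and> preserves U N P)"

section \<open>The structure associated with a solution of the system\<close>

text \<open>A point is a pair \<open>(x, y)\<close>, with both halves of the coordinates indexed by the same finite
  type.\<close>

definition partial_x ::
  "'n::finite \<Rightarrow> ((real^'n) \<times> (real^'n) \<Rightarrow> real) \<Rightarrow> (real^'n) \<times> (real^'n) \<Rightarrow> real" where
  "partial_x i g p = frechet_derivative g (at p) (axis i 1, 0)"

definition partial_y ::
  "'n::finite \<Rightarrow> ((real^'n) \<times> (real^'n) \<Rightarrow> real) \<Rightarrow> (real^'n) \<times> (real^'n) \<Rightarrow> real" where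
  "partial_y i g p = frechet_derivative g (at p) (0, axis i 1)"

definition solution_on ::
  "((real^'n) \<times> (real^'n)) set \<Rightarrow> ('n::finite \<Rightarrow> 'n \<Rightarrow> (real^'n) \<times> (real^'n) \<Rightarrow> real) \<Rightarrow> bool" where
  "solution_on U f \<longleftrightarrow> (\<forall>i j. smooth_on U (f i j)) \<and>
     (\<forall>p\<in>U. \<forall>i j t. i \<noteq> j \<longrightarrow>
        partial_x i (f j t) p - partial_x j (f i t) p +
        (\<Sum>k\<in>UNIV. f i k p * partial_y k (f j t) p - f j k p * partial_y k (f i t) p) = 0)"

definition coeff_matrix ::
  "('n::finite \<Rightarrow> 'n \<Rightarrow> (real^'n) \<times> (real^'n) \<Rightarrow> real) \<Rightarrow> (real^'n) \<times> (real^'n) \<Rightarrow> real^'n^'n" where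
  "coeff_matrix f p = (\<chi> i j. f i j p)"

text \<open>A tangent vector \<open>(a, b)\<close> has \<open>a\<close> in the span of the \<open>x\<close>-directions and \<open>b\<close> in the span of the
  \<open>y\<close>-directions. As \<open>A\<close> maps the \<open>i\<close>-th basis vector to the \<open>i\<close>-th row of the coefficient matrix, it
  is multiplication by that matrix from the right, and its inverse is multiplication by the inverse
  matrix from the right (provided the determinant is nonzero).\<close>

definition A_map ::
  "('n::finite \<Rightarrow> 'n \<Rightarrow> (real^'n) \<times> (real^'n) \<Rightarrow> real) \<Rightarrow> (real^'n) \<times> (real^'n) \<Rightarrow> real^'n \<Rightarrow> real^'n" where
  "A_map f p a = a v* coeff_matrix f p"

definition A_inv ::
  "('n::finite \<Rightarrow> 'n \<Rightarrow> (real^'n) \<times> (real^'n) \<Rightarrow> real) \<Rightarrow> (real^'n) \<times> (real^'n) \<Rightarrow> real^'n \<Rightarrow> real^'n" where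
  "A_inv f p b = b v* matrix_inv (coeff_matrix f p)"

definition J1_of ::
  "('n::finite \<Rightarrow> 'n \<Rightarrow> (real^'n) \<times> (real^'n) \<Rightarrow> real) \<Rightarrow>
   (real^'n) \<times> (real^'n) \<Rightarrow> ((real^'n) \<times> (real^'n)) \<Rightarrow>\<^sub>L ((real^'n) \<times> (real^'n))" where
  "J1_of f p = Blinfun (\<lambda>(a, b). (- A_inv f p b, A_map f p a))"

definition J2_of ::
  "('n::finite \<Rightarrow> 'n \<Rightarrow> (real^'n) \<times> (real^'n) \<Rightarrow> real) \<Rightarrow>
   (real^'n) \<times> (real^'n) \<Rightarrow> ((real^'n) \<times> (real^'n)) \<Rightarrow>\<^sub>L ((real^'n) \<times> (real^'n))" where
  "J2_of f p = Blinfun (\<lambda>(a, b). (a, - b))"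

definition J3_of ::
  "('n::finite \<Rightarrow> 'n \<Rightarrow> (real^'n) \<times> (real^'n) \<Rightarrow> real) \<Rightarrow>
   (real^'n) \<times> (real^'n) \<Rightarrow> ((real^'n) \<times> (real^'n)) \<Rightarrow>\<^sub>L ((real^'n) \<times> (real^'n))" where
  "J3_of f p = Blinfun (\<lambda>(a, b). (A_inv f p b, A_map f p a))"

definition associated_structure ::
  "('n::finite \<Rightarrow> 'n \<Rightarrow> (real^'n) \<times> (real^'n) \<Rightarrow> real) \<Rightarrow>
   (real^'n) \<times> (real^'n) \<Rightarrow> (((real^'n) \<times> (real^'n)) \<Rightarrow>\<^sub>L ((real^'n) \<times> (real^'n))) set" where
  "associated_structure f p = span {J1_of f p, J2_of f p, J3_of f p}"

lemma bounded_linear_A: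
  "bounded_linear (A_map f p)" "bounded_linear (A_inv f p)"
proof -
  have "bounded_linear (\<lambda>x. x v* M)" for M :: "real^'n^'n"
  proof -
    have "(\<lambda>x. x v* M) = (*v) (transpose M)"
      by (simp add: fun_eq_iff)
    then show ?thesis
      by simp
  qed
  then show "bounded_linear (A_map f p)" "bounded_linear (A_inv f p)"
    unfolding A_map_def A_inv_def by blast+
qed

lemma A_map_axis: "A_map f p (axis i 1) $ j = f i j p"
  by (simp add: A_map_def coeff_matrix_def vector_matrix_mult_def axis_def
      if_distrib[where f = "\<lambda>c. _ * c"] if_distrib[where f = "\<lambda>c. c * _"] cong: if_cong)

lemma A_inverse:
  assumes "det (coeff_matrix f p) \<noteq> 0"
  shows "A_inv f p (A_map f p a) = a" "A_map f p (A_inv f p b) = b"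
proof -
  let ?F = "coeff_matrix f p"
  have "\<exists>G. ?F ** G = mat 1 \<and> G ** ?F = mat 1"
    using assms by (simp add: invertible_det_nz[symmetric] invertible_def)
  then have "?F ** matrix_inv ?F = mat 1 \<and> matrix_inv ?F ** ?F = mat 1"
    unfolding matrix_inv_def by (rule someI_ex)
  then show "A_inv f p (A_map f p a) = a" "A_map f p (A_inv f p b) = b"
    by (simp_all add: A_map_def A_inv_def vector_matrix_mul_assoc)
qed

lemma J_apply:
  "blinfun_apply (J1_of f p) (a, b) = (- A_inv f p b, A_map f p a)"
  "blinfun_apply (J2_of f p) (a, b) = (a, - b)"
  "blinfun_apply (J3_of f p) (a, b) = (A_inv f p b, A_map f p a)"
proof -
  note bl = bounded_linear_compose[OF bounded_linear_A(1) bounded_linear_fst]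
    bounded_linear_compose[OF bounded_linear_A(2) bounded_linear_snd]
  have "bounded_linear (\<lambda>(a, b). (- A_inv f p b, A_map f p a))"
    "bounded_linear (\<lambda>(a::real^'a, b::real^'a). (a, - b))"
    "bounded_linear (\<lambda>(a, b). (A_inv f p b, A_map f p a))"
    unfolding split_beta
    by (intro bounded_linear_Pair bounded_linear_minus bl bounded_linear_fst bounded_linear_snd)+
  then show "blinfun_apply (J1_of f p) (a, b) = (- A_inv f p b, A_map f p a)"
    "blinfun_apply (J2_of f p) (a, b) = (a, - b)"
    "blinfun_apply (J3_of f p) (a, b) = (A_inv f p b, A_map f p a)"
    by (simp_all add: J1_of_def J2_of_def J3_of_def bounded_linear_Blinfun_apply)
qed

section \<open>The explicit functions\<close>

text \<open>The index \<open>e\<close> plays the role of the first index; the sums range over all the others.\<close>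

definition sqsum :: "'n::finite \<Rightarrow> real^'n \<Rightarrow> real" where
  "sqsum e x = (\<Sum>j\<in>UNIV - {e}. (x $ j)\<^sup>2)"

definition ratio :: "'n::finite \<Rightarrow> (real^'n) \<times> (real^'n) \<Rightarrow> real" where
  "ratio e p = sqsum e (fst p) / sqsum e (snd p)"

definition f_diag ::
  "'n::finite \<Rightarrow> (real \<Rightarrow> real) \<Rightarrow> 'n \<Rightarrow> (real^'n) \<times> (real^'n) \<Rightarrow> real" where
  "f_diag e h i p =
     (if i = e then h (ratio e p)
      else (fst p $ i * sqsum e (snd p)) / (snd p $ i * sqsum e (fst p)))"

definition f_mat ::
  "'n::finite \<Rightarrow> (real \<Rightarrow> real) \<Rightarrow> 'n \<Rightarrow> 'n \<Rightarrow> (real^'n) \<times> (real^'n) \<Rightarrow> real" where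
  "f_mat e h i j p = (if i = j then f_diag e h i p else 0)"

text \<open>All the functions are defined where no denominator vanishes and the argument of \<open>h\<close> lies in
  the domain \<open>D\<close> of \<open>h\<close>.\<close>

definition f_domain :: "'n::finite \<Rightarrow> real set \<Rightarrow> ((real^'n) \<times> (real^'n)) set" where
  "f_domain e D = {p. sqsum e (fst p) \<noteq> 0 \<and> sqsum e (snd p) \<noteq> 0 \<and>
     (\<forall>i. i \<noteq> e \<longrightarrow> snd p $ i \<noteq> 0) \<and> ratio e p \<in> D}"

end

theory Submission
  imports Defs
begin

text \<open>Put \<open>E\<^sub>i = \<partial>/\<partial>x\<^sub>i\<close> and \<open>F\<^sub>i = A E\<^sub>i = f\<^sub>i \<partial>/\<partial>y\<^sub>i\<close>. For diagonal coefficients the system says that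
  \<open>E\<^sub>i + F\<^sub>i\<close> annihilates \<open>f\<^sub>j\<close> for \<open>j \<noteq> i\<close>; here it does, because it annihilates both the ratio
  \<open>r\<close> of the two sums of squares and all coordinates other than \<open>x\<^sub>i\<close> and \<open>y\<^sub>i\<close>.

  If a torsion-free connection preserves the structure, then differentiating \<open>J\<^sub>2\<close> and \<open>J\<^sub>3\<close> shows
  \<open>\<nabla>\<^sub>X F\<^sub>j \<equiv> \<psi>(X) E\<^sub>j\<close> modulo the \<open>F\<^sub>k\<close>, and that the \<open>F\<close>-part of \<open>\<nabla>\<^sub>X F\<^sub>j\<close> is the image under \<open>A\<close> of
  the \<open>E\<close>-part of \<open>\<nabla>\<^sub>X E\<^sub>j\<close> plus \<open>\<chi>(X) F\<^sub>j\<close>, with \<open>\<psi>\<close> and \<open>\<chi>\<close> independent of \<open>j\<close>. Comparing the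
  \<open>F\<^sub>j\<close>-components of \<open>[F\<^sub>i, F\<^sub>j] = \<nabla>\<^sub>F\<^sub>i F\<^sub>j - \<nabla>\<^sub>F\<^sub>j F\<^sub>i\<close> gives \<open>F\<^sub>i (ln f\<^sub>j) = \<chi>(F\<^sub>i) - \<psi>(E\<^sub>i)\<close>, so this
  logarithmic derivative is the same for all \<open>j \<noteq> i\<close>. It is \<open>h'(r) F\<^sub>i(r) / h(r)\<close> for the first index and
  \<open>- F\<^sub>i(r) / r\<close> for any other one, which forces \<open>h(r) + r h'(r) = 0\<close>.\<close>

section \<open>Smooth functions\<close>


lemma Ck_on_cong:
  assumes "open U" "\<And>p. p \<in> U \<Longrightarrow> f p = g p" "Ck_on k U f"
  shows "Ck_on k U g"
  using assms
proof (induction k arbitrary: f g)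
  case 0
  then show ?case by (simp cong: continuous_on_cong)
next
  case (Suc k)
  \<comment> \<open>Since \<open>U\<close> is open, \<open>f\<close> and \<open>g\<close> agree near
    \<open>p\<close> and hence share their derivative there; equality at \<open>p\<close> alone
    would not suffice.\<close>
  have *: "g differentiable (at p) \<and> frechet_derivative g (at p) = frechet_derivative f (at p)"
    if "p \<in> U" for p
  proof -
    have "(f has_derivative frechet_derivative f (at p)) (at p)"
      using Suc.prems(3) that frechet_derivative_works by auto
    then have "(g has_derivative frechet_derivative f (at p)) (at p)"
      by (rule has_derivative_transform_within_open) (use Suc.prems that in auto)
    then show ?thesis
      by (metis differentiable_def frechet_derivative_at)
  qed
  have "Ck_on k U (\<lambda>p. frechet_derivative g (at p) v)" for v
    using Suc.IH[of "\<lambda>p. frechet_derivative f (at p) v" "\<lambda>p. frechet_derivative g (at p) v"]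
      * Suc.prems by simp
  then show ?case using * by simp
qed

text \<open>Uniqueness of the derivative lets any formula valid on \<open>U\<close> stand in for
  \<open>frechet_derivative\<close>, so each differentiation rule below turns into an induction on
  \<open>k\<close>.\<close>

lemma Ck_on_SucI:
  assumes "open U" "\<And>p. p \<in> U \<Longrightarrow> (f has_derivative f' p) (at p)" "\<And>v. Ck_on k U (\<lambda>p. f' p v)"
  shows "Ck_on (Suc k) U f"
proof -
  have "f' p = frechet_derivative f (at p)" if "p \<in> U" for p
    using assms(2) that by (simp add: frechet_derivative_at)
  then have "Ck_on k U (\<lambda>p. frechet_derivative f (at p) v)" for v
    using Ck_on_cong[OF assms(1) _ assms(3)[of v], of "\<lambda>p. frechet_derivative f (at p) v"] by simp
  then show ?thesis using assms(2) by (auto simp: differentiable_def)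
qed

lemma Ck_on_Suc_D:
  assumes "Ck_on (Suc k) U f" "p \<in> U"
  shows "(f has_derivative frechet_derivative f (at p)) (at p)"
  using assms frechet_derivative_works by auto

lemma Ck_on_Suc_frechet: "Ck_on (Suc k) U f \<Longrightarrow> Ck_on k U (\<lambda>p. frechet_derivative f (at p) v)"
  by simp

lemma Ck_on_Suc_imp: "Ck_on (Suc k) U f \<Longrightarrow> Ck_on k U f"
proof (induction k arbitrary: f)
  case 0
  then show ?case
    by (auto intro!: continuous_at_imp_continuous_on differentiable_imp_continuous_within)
next
  case (Suc k)
  then show ?case by (metis Ck_on.simps(2))
qed

lemma Ck_on_subset: "Ck_on k U f \<Longrightarrow> V \<subseteq> U \<Longrightarrow> Ck_on k V f"
  by (induction k arbitrary: f) (auto intro: continuous_on_subset)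

lemma Ck_on_const: "Ck_on k U (\<lambda>_. c)"
  by (induction k arbitrary: c) auto

lemma Ck_on_bounded_linear:
  assumes "open U" "bounded_linear f" shows "Ck_on k U f"
proof (cases k)
  case 0
  then show ?thesis using assms by (simp add: linear_continuous_on)
next
  case (Suc n)
  show ?thesis unfolding Suc
    by (rule Ck_on_SucI[where f'="\<lambda>p. f"])
      (use assms in \<open>auto intro: bounded_linear_imp_has_derivative Ck_on_const\<close>)
qed

lemma Ck_on_add:
  assumes "open U" "Ck_on k U f" "Ck_on k U g" shows "Ck_on k U (\<lambda>p. f p + g p)"
  using assms(2,3)
proof (induction k arbitrary: f g)
  case 0
  then show ?case by (auto intro: continuous_on_add)
next
  case (Suc k)
  show ?case
    by (rule Ck_on_SucI[OF assms(1) has_derivative_add[OF Ck_on_Suc_D[OF Suc.prems(1)]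
      Ck_on_Suc_D[OF Suc.prems(2)]]]) (use Suc in auto)
qed

text \<open>The Leibniz rule gives two terms of the same shape, each with one differentiated factor
  and one factor weakened by one order. This serves products of reals as well as scalar
  multiples.\<close>

lemma Ck_on_bilinear:
  assumes "open U" "bounded_bilinear B" "Ck_on k U f" "Ck_on k U g"
  shows "Ck_on k U (\<lambda>p. B (f p) (g p))"
  using assms(3,4)
proof (induction k arbitrary: f g)
  case 0
  then show ?case using bounded_bilinear.continuous_on[OF assms(2)] by auto
next
  case (Suc k)
  show ?case
    by (rule Ck_on_SucI[OF assms(1) bounded_bilinear.FDERIV[OF assms(2) Ck_on_Suc_D[OF Suc.prems(1)]
      Ck_on_Suc_D[OF Suc.prems(2)]]])
      (assumption | intro Ck_on_add[OF assms(1)] Suc.IH Suc.prems[THEN Ck_on_Suc_imp]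
        Suc.prems[THEN Ck_on_Suc_frechet])+
qed

text \<open>The derivative of 1/g is -(1/g) g' (1/g), where 1/g is one order lower by the induction
  hypothesis.\<close>

lemma Ck_on_inverse:
  fixes g :: "'a::real_normed_vector \<Rightarrow> real"
  assumes "open U" "Ck_on k U g" "\<And>p. p \<in> U \<Longrightarrow> g p \<noteq> 0"
  shows "Ck_on k U (\<lambda>p. inverse (g p))"
  using assms(2)
proof (induction k)
  case 0
  then show ?case using assms(3) by (auto intro: continuous_on_inverse)
next
  case (Suc k)
  note mult = Ck_on_bilinear[OF assms(1) bounded_bilinear_mult]
  have i: "Ck_on k U (\<lambda>p. inverse (g p))"
    using Suc.IH Ck_on_Suc_imp[OF Suc.prems] by blast
  show ?case
  proof (rule Ck_on_SucI[OF assms(1) Deriv.has_derivative_inverse[OF assms(3) Ck_on_Suc_D[OF Suc.prems]]])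
    fix v
    have "Ck_on k U (\<lambda>p. -1 * (inverse (g p) * frechet_derivative g (at p) v * inverse (g p)))"
      using Suc.prems by (intro mult i Ck_on_const) auto
    then show "Ck_on k U (\<lambda>p. - (inverse (g p) * frechet_derivative g (at p) v * inverse (g p)))"
      by simp
  qed auto
qed

text \<open>In one real variable the chain rule is a product of dg with h' composed with g. The
  latter is again such a composition, so the induction has to run over all \<open>h\<close>.\<close>

lemma Ck_on_compose_real:
  fixes g :: "'a::real_normed_vector \<Rightarrow> real" and h :: "real \<Rightarrow> real"
  assumes "open U" "Ck_on k U g" "Ck_on k D h" "\<And>p. p \<in> U \<Longrightarrow> g p \<in> D"
  shows "Ck_on k U (\<lambda>p. h (g p))"
  using assms(2,3)
proof (induction k arbitrary: h)
  case 0
  then show ?case using assms(4) continuous_on_compose2[of D h U g] by auto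
next
  case (Suc k)
  show ?case
  proof (rule Ck_on_SucI[OF assms(1) has_derivative_compose[OF Ck_on_Suc_D[OF Suc.prems(1)]
          Ck_on_Suc_D[OF Suc.prems(2) assms(4)]]])
    fix v
    have "Ck_on k U (\<lambda>p. frechet_derivative g (at p) v * frechet_derivative h (at (g p)) 1)"
      by (rule Ck_on_bilinear[OF assms(1) bounded_bilinear_mult Ck_on_Suc_frechet[OF Suc.prems(1)]
        Suc.IH[OF Ck_on_Suc_imp[OF Suc.prems(1)] Ck_on_Suc_frechet[OF Suc.prems(2)]]])
    then show "Ck_on k U (\<lambda>p. frechet_derivative h (at (g p)) (frechet_derivative g (at p) v))"
    proof (rule Ck_on_cong[OF assms(1), rotated])
      fix p assume "p \<in> U"
      then have "linear (frechet_derivative h (at (g p)))"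
        by (intro has_derivative_linear[OF Ck_on_Suc_D[OF Suc.prems(2) assms(4)]])
      from linear_scale[OF this, of "frechet_derivative g (at p) v" 1]
      show "frechet_derivative g (at p) v * frechet_derivative h (at (g p)) 1 =
          frechet_derivative h (at (g p)) (frechet_derivative g (at p) v)" by simp
    qed
  qed auto
qed

section \<open>The same closure properties for smooth maps\<close>

lemma smooth_on_const: "smooth_on U (\<lambda>_. c)"
  by (simp add: smooth_on_def Ck_on_const)

lemma smooth_on_subset: "smooth_on U f \<Longrightarrow> V \<subseteq> U \<Longrightarrow> smooth_on V f"
  by (auto simp: smooth_on_def intro: Ck_on_subset)

lemma smooth_on_cong:
  "open U \<Longrightarrow> (\<And>p. p \<in> U \<Longrightarrow> f p = g p) \<Longrightarrow> smooth_on U f \<Longrightarrow> smooth_on U g"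
  unfolding smooth_on_def using Ck_on_cong by blast

lemma smooth_on_has_derivative:
  "smooth_on U f \<Longrightarrow> p \<in> U \<Longrightarrow> (f has_derivative frechet_derivative f (at p)) (at p)"
  unfolding smooth_on_def using Ck_on_Suc_D by blast

lemma smooth_on_bounded_linear: "open U \<Longrightarrow> bounded_linear f \<Longrightarrow> smooth_on U f"
  by (simp add: smooth_on_def Ck_on_bounded_linear)

lemma smooth_on_add: "open U \<Longrightarrow> smooth_on U f \<Longrightarrow> smooth_on U g \<Longrightarrow> smooth_on U (\<lambda>p. f p + g p)"
  by (simp add: smooth_on_def Ck_on_add)

lemma smooth_on_sum:
  "open U \<Longrightarrow> (\<And>i. i \<in> I \<Longrightarrow> smooth_on U (f i)) \<Longrightarrow> smooth_on U (\<lambda>p. \<Sum>i\<in>I. f i p)"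
  by (induction I rule: infinite_finite_induct) (simp_all add: smooth_on_add smooth_on_const)

lemma smooth_on_scaleR:
  "open U \<Longrightarrow> smooth_on U f \<Longrightarrow> smooth_on U g \<Longrightarrow> smooth_on U (\<lambda>p. f p *\<^sub>R g p)"
  by (simp add: smooth_on_def Ck_on_bilinear[OF _ bounded_bilinear_scaleR])

lemma smooth_on_mult:
  fixes f g :: "'a::real_normed_vector \<Rightarrow> real"
  shows "open U \<Longrightarrow> smooth_on U f \<Longrightarrow> smooth_on U g \<Longrightarrow> smooth_on U (\<lambda>p. f p * g p)"
  by (simp add: smooth_on_def Ck_on_bilinear[OF _ bounded_bilinear_mult])

lemma smooth_on_inverse:
  fixes g :: "'a::real_normed_vector \<Rightarrow> real"
  shows "open U \<Longrightarrow> smooth_on U g \<Longrightarrow> (\<And>p. p \<in> U \<Longrightarrow> g p \<noteq> 0) \<Longrightarrow> smooth_on U (\<lambda>p. inverse (g p))"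
  by (simp add: smooth_on_def Ck_on_inverse)

lemma smooth_on_divide:
  fixes f g :: "'a::real_normed_vector \<Rightarrow> real"
  shows "open U \<Longrightarrow> smooth_on U f \<Longrightarrow> smooth_on U g \<Longrightarrow> (\<And>p. p \<in> U \<Longrightarrow> g p \<noteq> 0) \<Longrightarrow>
    smooth_on U (\<lambda>p. f p / g p)"
  by (simp add: divide_inverse smooth_on_mult smooth_on_inverse)

lemma smooth_on_compose_real:
  fixes g :: "'a::real_normed_vector \<Rightarrow> real" and h :: "real \<Rightarrow> real"
  shows "open U \<Longrightarrow> smooth_on U g \<Longrightarrow> smooth_on D h \<Longrightarrow> (\<And>p. p \<in> U \<Longrightarrow> g p \<in> D) \<Longrightarrow>
    smooth_on U (\<lambda>p. h (g p))"
  unfolding smooth_on_def by (blast intro: Ck_on_compose_real)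

section \<open>Structures with diagonal coefficients\<close>

text \<open>Isolates the only feature of \<open>f_mat\<close> that the structural arguments use.
  Here \<open>A\<close> just rescales each axis.\<close>

definition diag_coeff :: "('n::finite \<Rightarrow> (real^'n) \<times> (real^'n) \<Rightarrow> real) \<Rightarrow>
    'n \<Rightarrow> 'n \<Rightarrow> (real^'n) \<times> (real^'n) \<Rightarrow> real" where
  "diag_coeff g i j p = (if i = j then g i p else 0)"

lemma A_map_diag: "A_map (diag_coeff g) p a = (\<chi> j. a $ j * g j p)"
  by (simp add: A_map_def coeff_matrix_def vector_matrix_mult_def diag_coeff_def vec_eq_iff
      if_distrib[where f = "\<lambda>c. _ * c"] if_distrib[where f = "\<lambda>c. c * _"] mult.commute cong: if_cong)

lemma det_coeff_matrix_diag:
  assumes "\<And>i. g i p \<noteq> 0" shows "det (coeff_matrix (diag_coeff g) p) \<noteq> 0"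
proof -
  have "det (coeff_matrix (diag_coeff g) p) = (\<Prod>i\<in>UNIV. coeff_matrix (diag_coeff g) p $ i $ i)"
    by (rule det_diagonal) (simp add: coeff_matrix_def diag_coeff_def)
  then show ?thesis using assms by (simp add: coeff_matrix_def diag_coeff_def)
qed

lemma A_inv_diag:
  assumes "\<And>i. g i p \<noteq> 0" shows "A_inv (diag_coeff g) p b = (\<chi> j. b $ j / g j p)"
proof -
  have "b = A_map (diag_coeff g) p (\<chi> j. b $ j / g j p)"
    using assms by (simp add: A_map_diag vec_eq_iff)
  then show ?thesis by (metis A_inverse(1) det_coeff_matrix_diag assms)
qed

lemma smooth_on_J_diag:
  assumes "open U" "\<And>i. smooth_on U (g i)" "\<And>p i. p \<in> U \<Longrightarrow> g i p \<noteq> 0"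
  shows "smooth_on U (J1_of (diag_coeff g))" "smooth_on U (J2_of (diag_coeff g))"
    "smooth_on U (J3_of (diag_coeff g))"
proof -
  \<comment> \<open>\<open>P i\<close> and \<open>Q i\<close> are constant blocks exchanging the
    i-th x-axis and the i-th y-axis. \<open>J1_of\<close> and \<open>J3_of\<close> combine them with
    the smooth coefficients \<open>g i\<close> and \<open>c / g i\<close>, where \<open>c\<close> is
    -1 and 1 respectively.\<close>
  define P where "P i = Blinfun (\<lambda>(a::real^'a, b::real^'a). (0::real^'a, a $ i *\<^sub>R axis i (1::real)))" for i
  define Q where "Q i = Blinfun (\<lambda>(a::real^'a, b::real^'a). (b $ i *\<^sub>R axis i (1::real), 0::real^'a))" for i
  have bl: "bounded_linear (\<lambda>(a::real^'a, b::real^'a). (0::real^'a, a $ i *\<^sub>R axis i (1::real)))"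
    "bounded_linear (\<lambda>(a::real^'a, b::real^'a). (b $ i *\<^sub>R axis i (1::real), 0::real^'a))" for i
    unfolding split_beta
    by (intro bounded_linear_Pair bounded_linear_zero bounded_linear_fst bounded_linear_snd
      bounded_linear_compose[OF bounded_linear_scaleR_left]
      bounded_linear_compose[OF bounded_linear_vec_nth])+
  have P: "blinfun_apply (P i) (a, b) = (0, a $ i *\<^sub>R axis i 1)"
    and Q: "blinfun_apply (Q i) (a, b) = (b $ i *\<^sub>R axis i 1, 0)" for i a b
    using bl by (simp_all add: P_def Q_def bounded_linear_Blinfun_apply)
  have sum: "(\<Sum>k\<in>UNIV. c k * axis k 1 $ i) = c i" for c :: "'a \<Rightarrow> real" and i
    by (simp add: axis_def if_distrib[where f = "\<lambda>c. _ * c"] cong: if_cong)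
  have *: "smooth_on U J"
    if J: "\<And>p a b. p \<in> U \<Longrightarrow>
      blinfun_apply (J p) (a, b) = (c *\<^sub>R A_inv (diag_coeff g) p b, A_map (diag_coeff g) p a)" for c J
  proof (rule smooth_on_cong[OF assms(1)])
    fix p assume p: "p \<in> U"
    show "(\<Sum>i\<in>UNIV. g i p *\<^sub>R P i) + (\<Sum>i\<in>UNIV. (c * inverse (g i p)) *\<^sub>R Q i) = J p"
      using assms(3)[OF p]
      by (intro blinfun_eqI) (auto simp: J p blinfun.add_left blinfun.sum_left blinfun.scaleR_left P Q
          A_map_diag A_inv_diag sum_prod sum vec_eq_iff divide_inverse)
  next
    show "smooth_on U (\<lambda>p. (\<Sum>i\<in>UNIV. g i p *\<^sub>R P i) + (\<Sum>i\<in>UNIV. (c * inverse (g i p)) *\<^sub>R Q i))"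
      using assms by (intro smooth_on_add smooth_on_sum smooth_on_scaleR smooth_on_mult
          smooth_on_inverse smooth_on_const) auto
  qed
  show "smooth_on U (J1_of (diag_coeff g))"
    by (rule *[of _ "-1"]) (simp add: J_apply)
  show "smooth_on U (J3_of (diag_coeff g))"
    by (rule *[of _ 1]) (simp add: J_apply)
  \<comment> \<open>\<open>J2_of\<close> does not depend on the point, so its value at 0 represents
    it everywhere.\<close>
  show "smooth_on U (J2_of (diag_coeff g))"
    using smooth_on_const[of U "J2_of (diag_coeff g) 0"] by (simp add: J2_of_def[abs_def])
qed

section \<open>Algebra of the frame and the almost para-quaternionic property\<close>

lemma blinfun_J_eqI:
  fixes F G :: "((real^'n) \<times> (real^'n)) \<Rightarrow>\<^sub>L ((real^'n) \<times> (real^'n))"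
  assumes "\<And>a b. blinfun_apply F (a, b) = blinfun_apply G (a, b)" shows "F = G"
  using assms by (intro blinfun_eqI) auto

lemma J_relations:
  assumes "det (coeff_matrix f p) \<noteq> 0"
  shows "J1_of f p o\<^sub>L J1_of f p = - id_blinfun" "J2_of f p o\<^sub>L J2_of f p = id_blinfun"
    "J3_of f p o\<^sub>L J3_of f p = id_blinfun" "J2_of f p o\<^sub>L J3_of f p = - (J3_of f p o\<^sub>L J2_of f p)"
    "J1_of f p o\<^sub>L J2_of f p = J3_of f p" "J2_of f p o\<^sub>L J1_of f p = - J3_of f p"
    "J1_of f p o\<^sub>L J3_of f p = - J2_of f p" "J3_of f p o\<^sub>L J1_of f p = J2_of f p"
proof -
  have neg: "A_map f p (- a) = - A_map f p a" "A_inv f p (- a) = - A_inv f p a" for a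
    using bounded_linear_A[of f p] by (simp_all add: linear_neg bounded_linear.linear)
  show "J1_of f p o\<^sub>L J1_of f p = - id_blinfun" "J2_of f p o\<^sub>L J2_of f p = id_blinfun"
    "J3_of f p o\<^sub>L J3_of f p = id_blinfun" "J2_of f p o\<^sub>L J3_of f p = - (J3_of f p o\<^sub>L J2_of f p)"
    "J1_of f p o\<^sub>L J2_of f p = J3_of f p" "J2_of f p o\<^sub>L J1_of f p = - J3_of f p"
    "J1_of f p o\<^sub>L J3_of f p = - J2_of f p" "J3_of f p o\<^sub>L J1_of f p = J2_of f p"
    by (rule blinfun_J_eqI; simp add: J_apply A_inverse[OF assms] neg blinfun.minus_left)+
qed

text \<open>The complex structure swaps the two eigenspaces.\<close>

lemma dim_eigenspaces_eq:
  fixes I J :: "'v::euclidean_space \<Rightarrow>\<^sub>L 'v"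
  assumes "I o\<^sub>L I = - id_blinfun" "I o\<^sub>L J = - (J o\<^sub>L I)"
  shows "dim {v. blinfun_apply (J + id_blinfun) v = 0} = dim {v. blinfun_apply (J - id_blinfun) v = 0}"
    (is "dim ?A = dim ?B")
proof -
  have II: "I (I v) = - v" for v
    using arg_cong[OF assms(1), of "\<lambda>F. blinfun_apply F v"] by (simp add: blinfun.minus_left)
  have JI: "J (I v) = - I (J v)" for v
    using arg_cong[OF assms(2), of "\<lambda>F. blinfun_apply F v"] by (simp add: blinfun.minus_left)
  have inj: "inj (blinfun_apply I)"
    by (rule inj_on_inverseI[where g="\<lambda>v. - I v"]) (simp add: II)
  have "?B = blinfun_apply I ` ?A"
  proof (intro equalityI subsetI)
    fix v assume "v \<in> ?B"
    then have "- I v \<in> ?A" "v = I (- I v)"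
      by (simp_all add: blinfun.add_left blinfun.diff_left blinfun.minus_right JI II)
    then show "v \<in> blinfun_apply I ` ?A" by blast
  next
    fix v assume "v \<in> blinfun_apply I ` ?A"
    then show "v \<in> ?B"
      by (auto simp: blinfun.add_left blinfun.diff_left JI eq_neg_iff_add_eq_0[symmetric] blinfun.minus_right)
  qed
  then show ?thesis
    using dim_image_eq[of "blinfun_apply I" ?A] inj
    by (simp add: inj_on_subset[OF inj] bounded_linear.linear blinfun.bounded_linear_right)
qed

lemma dim_associated_structure:
  fixes f :: "'n::finite \<Rightarrow> 'n \<Rightarrow> (real^'n) \<times> (real^'n) \<Rightarrow> real"
  assumes "det (coeff_matrix f p) \<noteq> 0"
  shows "dim (associated_structure f p) = 3"
proof -
  \<comment> \<open>Any nonzero vector would do: the plane spanned by (a, 0) and (0, A a) is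
    invariant under the three endomorphisms, and their independence is already visible on
    it.\<close>
  let ?a = "axis undefined 1 :: real^'n"
  have Aa: "A_map f p ?a \<noteq> 0"
    using A_inverse(1)[OF assms, of ?a] bounded_linear_A(2)[of f p]
    by (auto simp: linear_0 bounded_linear.linear)
  have J: "blinfun_apply (J1_of f p) (?a, 0) = (0, A_map f p ?a)"
    "blinfun_apply (J2_of f p) (?a, 0) = (?a, 0)"
    "blinfun_apply (J3_of f p) (?a, 0) = (0, A_map f p ?a)"
    "blinfun_apply (J1_of f p) (0, A_map f p ?a) = (- ?a, 0)"
    "blinfun_apply (J2_of f p) (0, A_map f p ?a) = (0, - A_map f p ?a)"
    "blinfun_apply (J3_of f p) (0, A_map f p ?a) = (?a, 0)"
    using bounded_linear_A[of f p] A_inverse[OF assms]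
    by (simp_all add: J_apply linear_0 bounded_linear.linear)
  have 0: "a = 0 \<and> b = 0 \<and> c = 0"
    if "a *\<^sub>R J1_of f p + b *\<^sub>R J2_of f p + c *\<^sub>R J3_of f p = 0" for a b c
  proof -
    have "(b *\<^sub>R ?a, (a + c) *\<^sub>R A_map f p ?a) = 0"
      using arg_cong[OF that, of "\<lambda>F. blinfun_apply F (?a, 0)"]
      by (simp add: blinfun.add_left blinfun.scaleR_left J scaleR_add_left)
    moreover have "((c - a) *\<^sub>R ?a, - b *\<^sub>R A_map f p ?a) = 0"
      using arg_cong[OF that, of "\<lambda>F. blinfun_apply F (0, A_map f p ?a)"]
      by (simp add: blinfun.add_left blinfun.scaleR_left J scaleR_diff_left)
    ultimately show ?thesis using Aa by (auto simp: zero_prod_def axis_eq_0_iff)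
  qed
  have ne: "J1_of f p \<noteq> J2_of f p" "J1_of f p \<noteq> J3_of f p" "J2_of f p \<noteq> J3_of f p"
    using 0[of 1 "-1" 0] 0[of 1 0 "-1"] 0[of 0 1 "-1"] by auto
  have "independent {J1_of f p, J2_of f p, J3_of f p}"
    using 0 ne by (subst dependent_finite) (auto simp: add.assoc)
  then show ?thesis
    using ne by (simp add: associated_structure_def dim_span dim_eq_card_independent)
qed

lemma almost_para_quaternionic_diag:
  fixes g :: "'n::finite \<Rightarrow> (real^'n) \<times> (real^'n) \<Rightarrow> real"
  assumes "m \<ge> 2" "CARD('n) = 2 * m" "open U"
    and "\<And>i. smooth_on U (g i)" "\<And>p i. p \<in> U \<Longrightarrow> g i p \<noteq> 0"
  shows "almost_para_quaternionic U (associated_structure (diag_coeff g))"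
proof -
  note det = det_coeff_matrix_diag[of g, OF assms(5)]
  note rel = J_relations[OF det]
  note smooth = smooth_on_J_diag[of U g, OF assms(3-5)]
  have "almost_complex U (J1_of (diag_coeff g))"
    using smooth rel by (simp add: almost_complex_def)
  \<comment> \<open>\<open>J1_of\<close> anticommutes with both \<open>J2_of\<close> and
    \<open>J3_of\<close>, so it swaps the eigenspaces of each.\<close>
  moreover have "almost_para_complex U (J2_of (diag_coeff g))" "almost_para_complex U (J3_of (diag_coeff g))"
    unfolding almost_para_complex_def using smooth rel
    by (auto intro!: dim_eigenspaces_eq[where I="J1_of (diag_coeff g) p" for p])
  moreover have "subspace (associated_structure f p)" for f :: "'n \<Rightarrow> 'n \<Rightarrow> (real^'n) \<times> (real^'n) \<Rightarrow> real" and p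
    by (simp add: associated_structure_def)
  \<comment> \<open>The frame is global, so \<open>U\<close> itself serves as the neighbourhood of
    every point.\<close>
  ultimately have "\<exists>W J\<^sub>1 J\<^sub>2 J\<^sub>3. open W \<and> p \<in> W \<and> W \<subseteq> U \<and>
        almost_complex W J\<^sub>1 \<and> almost_para_complex W J\<^sub>2 \<and> almost_para_complex W J\<^sub>3 \<and>
        (\<forall>q\<in>W. J\<^sub>2 q o\<^sub>L J\<^sub>3 q = - (J\<^sub>3 q o\<^sub>L J\<^sub>2 q) \<and> J\<^sub>3 q = J\<^sub>1 q o\<^sub>L J\<^sub>2 q \<and>
           associated_structure (diag_coeff g) q = span {J\<^sub>1 q, J\<^sub>2 q, J\<^sub>3 q})" if "p \<in> U" for p
    using that assms(3) rel(4,5)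
    by (intro exI[of _ U] exI[of _ "J1_of (diag_coeff g)"] exI[of _ "J2_of (diag_coeff g)"]
       exI[of _ "J3_of (diag_coeff g)"]) (auto simp: associated_structure_def)
  then show ?thesis
    unfolding almost_para_quaternionic_def
    using assms(1,2) dim_associated_structure[OF det]
    by (auto simp: associated_structure_def)
qed

section \<open>The obstruction to a torsion-free connection\<close>

text \<open>The structure enters the obstruction only through these two proportionalities.\<close>

lemma associated_structure_offdiag:
  assumes "K \<in> associated_structure f p"
  shows "\<exists>s. \<forall>b. fst (blinfun_apply K (0, b)) = s *\<^sub>R A_inv f p b"
    and "\<exists>s. \<forall>a. snd (blinfun_apply K (a, 0)) = s *\<^sub>R A_map f p a"
proof -
  obtain a b c where "K = a *\<^sub>R J1_of f p + b *\<^sub>R J2_of f p + c *\<^sub>R J3_of f p"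
  proof -
    from assms obtain a where "K - a *\<^sub>R J1_of f p \<in> span {J2_of f p, J3_of f p}"
      unfolding associated_structure_def span_insert by blast
    then obtain b where "K - a *\<^sub>R J1_of f p - b *\<^sub>R J2_of f p \<in> span {J3_of f p}"
      unfolding span_insert[of "J2_of f p"] by blast
    then obtain c where "K - a *\<^sub>R J1_of f p - b *\<^sub>R J2_of f p = c *\<^sub>R J3_of f p"
      unfolding span_singleton by blast
    then show thesis by (intro that[of a b c]) (simp add: algebra_simps)
  qed
  then have "fst (blinfun_apply K (0, v)) = (c - a) *\<^sub>R A_inv f p v"
    "snd (blinfun_apply K (v, 0)) = (a + c) *\<^sub>R A_map f p v" for v
    by (simp_all add: J_apply blinfun.add_left blinfun.scaleR_left algebra_simps)
  then show "\<exists>s. \<forall>b. fst (blinfun_apply K (0, b)) = s *\<^sub>R A_inv f p b"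
    and "\<exists>s. \<forall>a. snd (blinfun_apply K (a, 0)) = s *\<^sub>R A_map f p a" by blast+
qed

text \<open>The Leibniz rule for the constant function -1, whose derivative vanishes.\<close>

lemma linear_connection_minus:
  assumes "linear_connection U N" "smooth_on U X" "smooth_on U Y" "p \<in> U"
  shows "N X (\<lambda>q. - Y q) p = - N X Y p"
proof -
  have "N X (\<lambda>q. (-1) *\<^sub>R Y q) p =
      frechet_derivative (\<lambda>_. -1 :: real) (at p) (X p) *\<^sub>R Y p + (-1) *\<^sub>R N X Y p"
    using assms smooth_on_const[of U "-1 :: real"] unfolding linear_connection_def by blast
  then show ?thesis by simp
qed

lemma lie_bracket_eqI:
  assumes "(X has_derivative X') (at p)" "(Y has_derivative Y') (at p)"
  shows "lie_bracket X Y p = Y' (X p) - X' (Y p)"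
  using assms by (simp add: lie_bracket_def frechet_derivative_at[symmetric])

text \<open>After division by \<open>g j p\<close>, all \<open>g j\<close> with
  \<open>j \<noteq> i\<close> have one common logarithmic derivative \<open>s\<close> along
  \<open>F i\<close>. This is the obstruction that the explicit functions violate.\<close>

lemma torsion_free_preserving_diag:
  fixes g :: "'n::finite \<Rightarrow> (real^'n) \<times> (real^'n) \<Rightarrow> real"
  assumes U: "open U" "p \<in> U"
    and g: "\<And>i. smooth_on U (g i)" "\<And>p i. p \<in> U \<Longrightarrow> g i p \<noteq> 0"
    and N: "linear_connection U N" "torsion_free U N"
      "preserves U N (associated_structure (diag_coeff g))"
  obtains s where "\<And>j. j \<noteq> i \<Longrightarrow>
    frechet_derivative (g j) (at p) (0, axis i (g i p)) = s * g j p"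
proof -
  define E where "E j = (\<lambda>_::(real^'n) \<times> (real^'n). (axis j 1 :: real^'n, 0 :: real^'n))" for j
  define F where "F j = (\<lambda>q::(real^'n) \<times> (real^'n). g j q *\<^sub>R (0 :: real^'n, axis j 1 :: real^'n))" for j
  have sE: "smooth_on U (E j)" for j
    by (simp add: E_def smooth_on_const)
  have sF: "smooth_on U (F j)" for j
    unfolding F_def by (intro smooth_on_scaleR smooth_on_const U g)
  note gp = g(2)[OF U(2)]
  have dE: "(E j has_derivative (\<lambda>_. 0)) (at p)" for j
    by (simp add: E_def)
  have dF: "(F j has_derivative (\<lambda>v. frechet_derivative (g j) (at p) v *\<^sub>R (0, axis j 1))) (at p)" for j
    unfolding F_def
    using has_derivative_scaleR_left[OF smooth_on_has_derivative[OF g(1) U(2)]] by blast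
  have F_axis: "F j q = (0, axis j (g j q))" for j q
    by (simp add: F_def axis_def vec_eq_iff)
  have inv_axis: "A_inv (diag_coeff g) p (axis j (g j p)) = axis j 1" for j
    using gp by (simp add: A_inv_diag vec_eq_iff axis_def)
  have J2F: "blinfun_apply (J2_of (diag_coeff g) q) (F j q) = - F j q" for j q
    by (simp add: F_def J_apply)
  have J3E: "blinfun_apply (J3_of (diag_coeff g) q) (E j q) = F j q" for j q
    using bounded_linear_A[of "diag_coeff g" q]
    by (auto simp: E_def F_def J_apply A_map_diag linear_0 bounded_linear.linear vec_eq_iff axis_def)
  have sec: "bundle_section U (associated_structure (diag_coeff g)) (J2_of (diag_coeff g))"
    "bundle_section U (associated_structure (diag_coeff g)) (J3_of (diag_coeff g))"
    using smooth_on_J_diag[of U g, OF U(1) g]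
    by (auto simp: bundle_section_def associated_structure_def intro: span_base)
  \<comment> \<open>This yields \<psi>. Since \<open>J2_of\<close> is -1 on \<open>F j\<close>, the
    x-part of its covariant derivative applied to \<open>F j\<close> is -2 times that of
    \<open>N X (F j)\<close>. It is also a multiple of \<open>E j\<close>, with a factor independent
    of \<open>j\<close>.\<close>
  have NF_fst: "\<exists>s. \<forall>j. fst (N X (F j) p) = s *\<^sub>R axis j 1" if X: "smooth_on U X" for X
  proof -
    obtain K where K: "bundle_section U (associated_structure (diag_coeff g)) K"
      and KY: "\<And>Y. smooth_on U Y \<Longrightarrow> blinfun_apply (K p) (Y p) =
          N X (\<lambda>q. blinfun_apply (J2_of (diag_coeff g) q) (Y q)) p
          - blinfun_apply (J2_of (diag_coeff g) p) (N X Y p)"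
      using N(3) X sec(1) U(2) unfolding preserves_def by blast
    obtain s where s: "\<And>b. fst (blinfun_apply (K p) (0, b)) = s *\<^sub>R A_inv (diag_coeff g) p b"
      using associated_structure_offdiag(1) K U(2) unfolding bundle_section_def by blast
    have "fst (N X (F j) p) = (- s / 2) *\<^sub>R axis j 1" for j
    proof -
      have "fst (blinfun_apply (K p) (F j p)) = - 2 *\<^sub>R fst (N X (F j) p)"
        using KY[OF sF] linear_connection_minus[OF N(1) X sF U(2)]
        by (cases "N X (F j) p") (simp add: J2F J_apply scaleR_2)
      moreover have "fst (blinfun_apply (K p) (F j p)) = s *\<^sub>R axis j 1"
        using s[of "axis j (g j p)"] by (simp add: F_axis inv_axis)
      ultimately show ?thesis by (simp add: vec_eq_iff)
    qed
    then show ?thesis by blast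
  qed
  \<comment> \<open>This yields \<chi>. Since \<open>J3_of\<close> sends \<open>E j\<close> to
    \<open>F j\<close>, the y-part of its covariant derivative applied to \<open>E j\<close> is the
    y-part of \<open>N X (F j)\<close> minus the image under \<open>A\<close> of the x-part of
    \<open>N X (E j)\<close>. It is also a multiple of \<open>F j\<close>, with a factor independent
    of \<open>j\<close>.\<close>
  have NF_snd: "\<exists>s. \<forall>j k. snd (N X (F j) p) $ k =
      g k p * fst (N X (E j) p) $ k + s * (if k = j then g j p else 0)" if X: "smooth_on U X" for X
  proof -
    obtain K where K: "bundle_section U (associated_structure (diag_coeff g)) K"
      and KY: "\<And>Y. smooth_on U Y \<Longrightarrow> blinfun_apply (K p) (Y p) =
          N X (\<lambda>q. blinfun_apply (J3_of (diag_coeff g) q) (Y q)) p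
          - blinfun_apply (J3_of (diag_coeff g) p) (N X Y p)"
      using N(3) X sec(2) U(2) unfolding preserves_def by blast
    obtain s where s: "\<And>a. snd (blinfun_apply (K p) (a, 0)) = s *\<^sub>R A_map (diag_coeff g) p a"
      using associated_structure_offdiag(2) K U(2) unfolding bundle_section_def by blast
    have "snd (N X (F j) p) $ k =
      g k p * fst (N X (E j) p) $ k + s * (if k = j then g j p else 0)" for j k
    proof -
      have "snd (blinfun_apply (K p) (E j p)) = snd (N X (F j) p) - A_map (diag_coeff g) p (fst (N X (E j) p))"
        using KY[OF sE] by (cases "N X (E j) p") (simp add: J3E J_apply)
      moreover have "snd (blinfun_apply (K p) (E j p)) = s *\<^sub>R A_map (diag_coeff g) p (axis j 1)"
        using s by (simp add: E_def)
      ultimately have "snd (N X (F j) p) = A_map (diag_coeff g) p (fst (N X (E j) p))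
          + s *\<^sub>R A_map (diag_coeff g) p (axis j 1)" by (simp add: algebra_simps)
      then show ?thesis by (simp add: A_map_diag axis_def)
    qed
    then show ?thesis by blast
  qed
  \<comment> \<open>\<open>E k\<close> is constant and \<open>F j\<close> has no x-part, so their
    bracket has no x-part either.\<close>
  have EF: "fst (N (E k) (F j) p) = fst (N (F j) (E k) p)" for j k
  proof -
    have "N (E k) (F j) p - N (F j) (E k) p = lie_bracket (E k) (F j) p"
      using N(2) sE sF U(2) unfolding torsion_free_def by (metis eq_iff_diff_eq_0)
    then have "fst (N (E k) (F j) p - N (F j) (E k) p) = 0"
      by (simp add: lie_bracket_eqI[OF dE dF])
    then show ?thesis by simp
  qed
  \<comment> \<open>The bracket is F_i(g_j) times the j-th y-axis minus F_j(g_i) times the i-th one;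
    only the first term has a j-th component.\<close>
  have FF: "snd (N (F i) (F j) p) $ j - snd (N (F j) (F i) p) $ j
      = frechet_derivative (g j) (at p) (F i p)" if "j \<noteq> i" for j
  proof -
    have "N (F i) (F j) p - N (F j) (F i) p = lie_bracket (F i) (F j) p"
      using N(2) sF U(2) unfolding torsion_free_def by (metis eq_iff_diff_eq_0)
    then have "snd (N (F i) (F j) p - N (F j) (F i) p) $ j = frechet_derivative (g j) (at p) (F i p)"
      using that by (simp add: lie_bracket_eqI[OF dF dF] axis_def)
    then show ?thesis by simp
  qed
  \<comment> \<open>\<open>s\<close> is \<psi>(E_i), and \<open>s'\<close> below is
    \<chi>(F_i).\<close>
  obtain s where s: "\<And>j. fst (N (E i) (F j) p) = s *\<^sub>R axis j 1"
    using NF_fst[OF sE] by blast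
  obtain s' where s': "\<And>j k. snd (N (F i) (F j) p) $ k =
      g k p * fst (N (F i) (E j) p) $ k + s' * (if k = j then g j p else 0)"
    using NF_snd[OF sF] by blast
  show thesis
  proof (rule that)
    fix j assume ji: "j \<noteq> i"
    \<comment> \<open>The x-part of \<open>N (E j) (F i)\<close> lies on the i-th axis, so by
      \<open>EF\<close> that of \<open>N (F i) (E j)\<close> has no j-th component and only the
      \<chi>-term survives.\<close>
    obtain t where "fst (N (E j) (F i) p) = t *\<^sub>R axis i 1"
      using NF_fst[OF sE] by blast
    then have "fst (N (F i) (E j) p) $ j = 0"
      using EF[of j i] ji by (simp add: axis_def)
    then have "snd (N (F i) (F j) p) $ j = s' * g j p"
      using s' by simp
    \<comment> \<open>Here the component index differs from that of the differentiated field, so the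
      \<chi>-term drops out and \<open>EF\<close> leaves \<psi>(E_i).\<close>
    moreover have "snd (N (F j) (F i) p) $ j = g j p * fst (N (F j) (E i) p) $ j"
      using NF_snd[OF sF, of j] ji by auto
    moreover have "fst (N (F j) (E i) p) $ j = s"
      using s[of j] EF[of i j] by simp
    ultimately show "frechet_derivative (g j) (at p) (0, axis i (g i p)) = (s' - s) * g j p"
      using FF[OF ji] by (simp add: F_axis algebra_simps)
  qed
qed


section \<open>The explicit solution\<close>

lemma sum_axis_minus:
  fixes x :: "real^'n"
  shows "(\<Sum>j\<in>UNIV - {e}. x $ j * axis i c $ j) = (if i = e then 0 else x $ i * c)"
  by (simp add: axis_def if_distrib[where f = "\<lambda>c. _ * c"] cong: if_cong)

text \<open>The differential of \<open>ratio e\<close>, with the quotient rule arranged as dN/S -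
  (N/S) dS/S so that the ratio itself reappears.\<close>

definition dratio :: "'n::finite \<Rightarrow> (real^'n) \<times> (real^'n) \<Rightarrow> (real^'n) \<times> (real^'n) \<Rightarrow> real" where
  "dratio e p w = 2 * (\<Sum>j\<in>UNIV - {e}. fst p $ j * fst w $ j) / sqsum e (snd p)
     - ratio e p * (2 * (\<Sum>j\<in>UNIV - {e}. snd p $ j * snd w $ j)) / sqsum e (snd p)"

lemma dratio_axis:
  "dratio e p (axis i a, axis i b) = (if i = e then 0 else
     2 * fst p $ i * a / sqsum e (snd p) - ratio e p * (2 * snd p $ i * b) / sqsum e (snd p))"
  by (simp add: dratio_def sum_axis_minus)

lemma has_derivative_ratio:
  assumes "sqsum e (snd p) \<noteq> 0"
  shows "(ratio e has_derivative dratio e p) (at p)"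
proof -
  have "((\<lambda>p. sqsum e (fst p)) has_derivative (\<lambda>w. 2 * (\<Sum>j\<in>UNIV - {e}. fst p $ j * fst w $ j))) (at p)"
    "((\<lambda>p. sqsum e (snd p)) has_derivative (\<lambda>w. 2 * (\<Sum>j\<in>UNIV - {e}. snd p $ j * snd w $ j))) (at p)"
    unfolding sqsum_def
    by (auto intro!: derivative_eq_intros bounded_linear.has_derivative[OF bounded_linear_vec_nth]
        simp: sum_distrib_left algebra_simps)
  from has_derivative_divide[OF this assms] show ?thesis
    using assms unfolding ratio_def[abs_def] dratio_def[abs_def]
    by (simp add: field_simps)
qed

lemma has_derivative_f_diag_first:
  assumes "p \<in> f_domain e D" "smooth_on D h"
  shows "(f_diag e h e has_derivative (\<lambda>w. deriv h (ratio e p) * dratio e p w)) (at p)"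
proof -
  have p: "sqsum e (snd p) \<noteq> 0" "ratio e p \<in> D"
    using assms(1) by (auto simp: f_domain_def)
  have "h differentiable (at (ratio e p))"
    using smooth_on_has_derivative[OF assms(2) p(2)] by (auto simp: differentiable_def)
  then have "(h has_derivative (*) (deriv h (ratio e p))) (at (ratio e p))"
    by (simp add: DERIV_deriv_iff_real_differentiable has_field_derivative_imp_has_derivative)
  from has_derivative_compose[OF has_derivative_ratio[OF p(1)] this]
  show ?thesis by (simp add: f_diag_def[abs_def])
qed

text \<open>In this form the sums of squares enter only through the ratio, whose differential is
  already available.\<close>

lemma f_diag_other: "i \<noteq> e \<Longrightarrow> f_diag e h i p = fst p $ i / (snd p $ i * ratio e p)"
  by (simp add: f_diag_def ratio_def)

text \<open>Logarithmic differentiation of x_i / (y_i r). The first term is kept free of division by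
  x_i, which may vanish on \<open>f_domain\<close>.\<close>

lemma has_derivative_f_diag_other:
  assumes "p \<in> f_domain e D" "i \<noteq> e"
  shows "(f_diag e h i has_derivative (\<lambda>w. fst w $ i / (snd p $ i * ratio e p)
    - f_diag e h i p * snd w $ i / snd p $ i - f_diag e h i p * dratio e p w / ratio e p)) (at p)"
proof -
  have p: "sqsum e (snd p) \<noteq> 0" "snd p $ i \<noteq> 0" "ratio e p \<noteq> 0"
    using assms by (auto simp: f_domain_def ratio_def)
  have n: "((\<lambda>p. fst p $ i) has_derivative (\<lambda>w. fst w $ i)) (at p)"
    "((\<lambda>p. snd p $ i) has_derivative (\<lambda>w. snd w $ i)) (at p)"
    by (auto intro!: bounded_linear.has_derivative[OF bounded_linear_vec_nth] derivative_intros)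
  have "((\<lambda>p. fst p $ i / (snd p $ i * ratio e p)) has_derivative
      (\<lambda>w. fst w $ i / (snd p $ i * ratio e p)
    - f_diag e h i p * snd w $ i / snd p $ i - f_diag e h i p * dratio e p w / ratio e p)) (at p)"
    by (rule has_derivative_eq_rhs[OF has_derivative_divide[OF n(1)
        has_derivative_mult[OF n(2) has_derivative_ratio[OF p(1)]]]])
      (use p assms(2) in \<open>auto simp: f_diag_other field_simps\<close>)
  moreover have "(\<lambda>p. fst p $ i / (snd p $ i * ratio e p)) = f_diag e h i"
    using assms(2) by (simp add: f_diag_other fun_eq_iff)
  ultimately show ?thesis by simp
qed

lemma f_diag_derivative_along_frame:
  assumes "p \<in> f_domain e D" "smooth_on D h" "i \<noteq> j"
  shows "frechet_derivative (f_diag e h j) (at p) (axis i 1, axis i (f_diag e h i p)) = 0"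
proof -
  \<comment> \<open>For \<open>i \<noteq> e\<close> the two terms cancel because r y_i f_i = x_i;
    for \<open>i = e\<close> the ratio does not involve the direction.\<close>
  have "dratio e p (axis i 1, axis i (f_diag e h i p)) = 0"
    using assms(1) by (auto simp: dratio_axis f_diag_other f_domain_def ratio_def)
  then show ?thesis
    using frechet_derivative_at[OF has_derivative_f_diag_first[OF assms(1,2)], symmetric]
      frechet_derivative_at[OF has_derivative_f_diag_other[OF assms(1), of j h], symmetric] assms(3)
    by (cases "j = e") (simp_all add: axis_def)
qed

section \<open>Openness of the domain and smoothness of the functions on it\<close>

lemma smooth_on_coord:
  fixes U :: "((real^'n) \<times> (real^'n)) set"
  assumes "open U"
  shows "smooth_on U (\<lambda>p. fst p $ i)" "smooth_on U (\<lambda>p. snd p $ i)"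
  by (intro smooth_on_bounded_linear[OF assms] bounded_linear_compose[OF bounded_linear_vec_nth]
      bounded_linear_fst bounded_linear_snd)+

lemma smooth_on_sqsum:
  fixes U :: "((real^'n) \<times> (real^'n)) set"
  assumes "open U"
  shows "smooth_on U (\<lambda>p. sqsum e (fst p))" "smooth_on U (\<lambda>p. sqsum e (snd p))"
  unfolding sqsum_def power2_eq_square
  by (intro smooth_on_sum smooth_on_mult smooth_on_coord assms)+

lemma open_f_domain:
  fixes e :: "'n::finite"
  assumes "open D" shows "open (f_domain e D)"
proof -
  let ?W = "{p::(real^'n) \<times> (real^'n). sqsum e (fst p) \<noteq> 0} \<inter> {p. sqsum e (snd p) \<noteq> 0}
    \<inter> (\<Inter>i\<in>- {e}. {p. snd p $ i \<noteq> 0})"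
  have "open ?W"
    unfolding sqsum_def
    by (intro open_Int open_INT ballI open_Collect_neq continuous_intros) auto
  \<comment> \<open>The preimage of \<open>D\<close> is taken inside \<open>?W\<close>, where the
    denominator of the ratio cannot vanish.\<close>
  moreover have "continuous_on ?W (ratio e)"
    by (intro continuous_at_imp_continuous_on ballI has_derivative_continuous[OF has_derivative_ratio]) auto
  ultimately have "open (?W \<inter> ratio e -` D)"
    using assms by (blast intro: continuous_open_preimage)
  also have "?W \<inter> ratio e -` D = f_domain e D"
    by (auto simp: f_domain_def)
  finally show ?thesis .
qed

lemma smooth_on_f_diag:
  assumes "open D" "smooth_on D h"
  shows "smooth_on (f_domain e D) (f_diag e h i)"
proof (cases "i = e")
  case True
  have "smooth_on (f_domain e D) (\<lambda>p. h (ratio e p))"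
    unfolding ratio_def
    by (intro smooth_on_compose_real[OF _ _ assms(2)] smooth_on_divide smooth_on_sqsum open_f_domain assms)
      (auto simp: f_domain_def ratio_def)
  then show ?thesis using True by (simp add: f_diag_def[abs_def])
next
  case False
  then show ?thesis
    unfolding f_diag_def[abs_def]
    by (simp, intro smooth_on_divide smooth_on_mult smooth_on_coord smooth_on_sqsum open_f_domain assms)
      (auto simp: f_domain_def)
qed

section \<open>The system of equations and the failure of para-quaternionicity\<close>

lemma f_mat_eq_diag_coeff: "f_mat e h = diag_coeff (f_diag e h)"
  by (simp add: fun_eq_iff f_mat_def diag_coeff_def)

text \<open>With diagonal coefficients the sum keeps only \<open>k = i\<close> and
  \<open>k = j\<close>. The left side is then E_i + F_i applied to f_jt minus E_j + F_j applied to
  f_it, and both terms vanish.\<close>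

lemma solution_on_f_mat:
  assumes "open D" "smooth_on D h"
  shows "solution_on (f_domain e D) (f_mat e h)"
  unfolding solution_on_def
proof (intro conjI allI ballI impI)
  fix i j
  show "smooth_on (f_domain e D) (f_mat e h i j)"
    using smooth_on_f_diag[OF assms] smooth_on_const by (cases "i = j") (simp_all add: f_mat_def[abs_def])
next
  fix p i j t assume p: "p \<in> f_domain e D" and ij: "i \<noteq> (j::'a)"
  have f: "f_mat e h k t = (if k = t then f_diag e h t else (\<lambda>_. 0))" for k t
    by (auto simp: fun_eq_iff f_mat_def)
  have *: "partial_x i (f_mat e h j t) p + f_diag e h i p * partial_y i (f_mat e h j t) p = 0"
    if "i \<noteq> j" for i j
  proof (cases "j = t")
    case True
    have "linear (frechet_derivative (f_diag e h t) (at p))"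
      by (rule has_derivative_linear[OF smooth_on_has_derivative[OF smooth_on_f_diag[OF assms] p]])
    then have "frechet_derivative (f_diag e h t) (at p) ((axis i 1, 0) + f_diag e h i p *\<^sub>R (0, axis i 1)) =
      frechet_derivative (f_diag e h t) (at p) (axis i 1, 0)
      + f_diag e h i p * frechet_derivative (f_diag e h t) (at p) (0, axis i 1)"
      by (simp only: linear_add linear_scale real_scaleR_def)
    moreover have "(axis i 1, 0) + f_diag e h i p *\<^sub>R (0, axis i 1) = (axis i 1, axis i (f_diag e h i p))"
      by (simp add: vec_eq_iff axis_def)
    ultimately show ?thesis
      using f_diag_derivative_along_frame[OF p assms(2), of i t] that True
      by (simp add: f partial_x_def partial_y_def)
  qed (simp add: f partial_x_def partial_y_def)
  have "(\<Sum>k\<in>UNIV. f_mat e h i k p * partial_y k (f_mat e h j t) p - f_mat e h j k p * partial_y k (f_mat e h i t) p)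
     = f_diag e h i p * partial_y i (f_mat e h j t) p - f_diag e h j p * partial_y j (f_mat e h i t) p"
    by (simp add: sum_subtractf f_mat_def[of e h _ _ p] if_distrib[where f = "\<lambda>c. c * _"] cong: if_cong)
  then show "partial_x i (f_mat e h j t) p - partial_x j (f_mat e h i t) p +
      (\<Sum>k\<in>UNIV. f_mat e h i k p * partial_y k (f_mat e h j t) p - f_mat e h j k p * partial_y k (f_mat e h i t) p) = 0"
    using *[OF ij] *[of j i] ij by simp
qed

lemma not_para_quaternionic_f_mat:
  fixes e :: "'n::finite"
  assumes "3 \<le> CARD('n)" "open D" "smooth_on D h" "open U" "p \<in> U" "U \<subseteq> f_domain e D"
    and nz: "\<And>q i. q \<in> U \<Longrightarrow> f_diag e h i q \<noteq> 0"
    and h: "h (ratio e p) + ratio e p * deriv h (ratio e p) \<noteq> 0"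
  shows "\<not> para_quaternionic U (associated_structure (f_mat e h))"
proof
  assume "para_quaternionic U (associated_structure (f_mat e h))"
  then obtain N where N: "linear_connection U N" "torsion_free U N"
    "preserves U N (associated_structure (diag_coeff (f_diag e h)))"
    by (auto simp: para_quaternionic_def f_mat_eq_diag_coeff)
  \<comment> \<open>Three indices are at hand, so a direction \<open>i\<close> other than
    \<open>e\<close> can be chosen together with an index \<open>t\<close> other than both. The
    logarithmic derivatives along F_i are compared at \<open>e\<close> and at
    \<open>t\<close>.\<close>
  have "UNIV \<noteq> {e}"
  proof
    assume "UNIV = {e}"
    from arg_cong[OF this, of card] show False using assms(1) by simp
  qed
  then obtain i where i: "i \<noteq> e" by blast
  have "UNIV \<noteq> {e, i}"
  proof
    assume "UNIV = {e, i}"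
    from arg_cong[OF this, of card] show False using assms(1) i by simp
  qed
  then obtain t where t: "t \<noteq> e" "t \<noteq> i" by blast
  obtain s where s: "\<And>j. j \<noteq> i \<Longrightarrow>
    frechet_derivative (f_diag e h j) (at p) (0, axis i (f_diag e h i p)) = s * f_diag e h j p"
    by (rule torsion_free_preserving_diag[where i = i,
        OF assms(4,5) smooth_on_subset[OF smooth_on_f_diag[OF assms(2,3)] assms(6)] nz N]) auto
  have p: "p \<in> f_domain e D" using assms by blast
  \<comment> \<open>\<open>d\<close> is the derivative of the ratio along F_i.\<close>
  define d where "d = dratio e p (0, axis i (f_diag e h i p))"
  have r: "ratio e p \<noteq> 0" using p by (auto simp: f_domain_def ratio_def)
  have "d = - (ratio e p * (2 * snd p $ i * f_diag e h i p) / sqsum e (snd p))"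
    using i dratio_axis[of e p i 0] by (simp add: d_def axis_eq_0_iff[THEN iffD2])
  then have d: "d \<noteq> 0"
    using nz[OF assms(5), of i] p i r by (auto simp: f_domain_def)
  have "deriv h (ratio e p) * d = s * h (ratio e p)"
    using s[of e] i frechet_derivative_at[OF has_derivative_f_diag_first[OF p assms(3)], symmetric]
    by (simp add: d_def f_diag_def)
  moreover have "- f_diag e h t p * d / ratio e p = s * f_diag e h t p"
    using s[OF t(2)] t frechet_derivative_at[OF has_derivative_f_diag_other[OF p t(1), of h], symmetric]
    by (simp add: d_def axis_def)
  then have "(s + d / ratio e p) * f_diag e h t p = 0"
    by (simp add: algebra_simps)
  then have "s = - d / ratio e p"
    using nz[OF assms(5), of t] by (simp add: add_eq_0_iff)
  \<comment> \<open>Eliminate \<open>s\<close> from h' d = s h and s = -d/r.\<close>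
  ultimately have "d * (h (ratio e p) + ratio e p * deriv h (ratio e p)) = 0"
    using r by (simp add: field_simps)
  then show False using d h by simp
qed

theorem proposition18:
  fixes m :: nat and e :: "'n::finite" and h :: "real \<Rightarrow> real" and D :: "real set"
  assumes "m \<ge> 2" and "CARD('n) = 2 * m"
    and "open D" and "smooth_on D h"
  shows "solution_on (f_domain e D) (f_mat e h) \<and>
    (\<forall>U :: ((real^'n) \<times> (real^'n)) set.
       open U \<longrightarrow> connected U \<longrightarrow> U \<noteq> {} \<longrightarrow> U \<subseteq> f_domain e D \<longrightarrow>
       (\<forall>p\<in>U. \<forall>i. f_diag e h i p \<noteq> 0) \<longrightarrow>
       (\<forall>p\<in>U. h (ratio e p) + ratio e p * deriv h (ratio e p) \<noteq> 0) \<longrightarrow>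
       almost_para_quaternionic U (associated_structure (f_mat e h)) \<and>
       \<not> para_quaternionic U (associated_structure (f_mat e h)))"
proof (intro conjI allI impI)
  show "solution_on (f_domain e D) (f_mat e h)"
    by (rule solution_on_f_mat[OF assms(3,4)])
next
  fix U :: "((real^'n) \<times> (real^'n)) set"
  assume U: "open U" "U \<subseteq> f_domain e D" and nz: "\<forall>p\<in>U. \<forall>i. f_diag e h i p \<noteq> 0"
  show "almost_para_quaternionic U (associated_structure (f_mat e h))"
    unfolding f_mat_eq_diag_coeff
    by (rule almost_para_quaternionic_diag[OF assms(1,2) U(1)
          smooth_on_subset[OF smooth_on_f_diag[OF assms(3,4)] U(2)]]) (use nz in blast)
  assume "U \<noteq> {}" and h: "\<forall>p\<in>U. h (ratio e p) + ratio e p * deriv h (ratio e p) \<noteq> 0"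
  then obtain p where "p \<in> U" by blast
  then show "\<not> para_quaternionic U (associated_structure (f_mat e h))"
    using not_para_quaternionic_f_mat[of D h U p e] assms U nz h by simp
qed

end
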